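(* Let $(X,\|\cdot\|_X)$ be a real Banach space, let $A\subset X$ be a convex origin-symmetric compact set with $\mathrm{diam}(A,X)<\infty$, and let $n\in\mathbb{N}$. Let $\phi_1,\dots,\phi_n\in X^{\ast}$ be such that $$\sup\{\|x\|_X : x\in A,\ \langle x,\phi_k\rangle=0,\ 1\le k\le n\}\le d^n(A,X)+\epsilon\quad\text{for all }\epsilon>0,$$ and let $c_k:B(X^{\ast})\to\mathbb{R}$, $1\le k\le n$, be (bounded) functionals of the best approximation of $\phi\in B(X^{\ast})$ by $\mathrm{lin}\{\phi_1,\dots,\phi_n\}$ in the norm $\|\cdot\|_{(\mathrm{lin}(A))^{\ast}}$, i.e. for every $\phi\in B(X^{\ast})$ $$\Big\|\phi-\sum_{k=1}^n c_k(\phi)\phi_k\Big\|_{(\mathrm{lin}(A))^{\ast}}=\inf_{a_1,\dots,a_n\in\mathbb{R}}\Big\|\phi-\sum_{k=1}^n a_k\phi_k\Big\|_{(\mathrm{lin}(A))^{\ast}}.$$ Put $[c_k]=0$ if $c_k\in X^{\ast\ast}$ and $[c_k]=c_k$ if $c_k\notin X^{\ast\ast}$. Let $\overline{X}=\mathrm{lin}\{X^{\ast\ast},[c_1],\dots,[c_n]\}\subset\widehat{X}$, with the norm of $\widehat{X}$, and let $\mathrm{j}:X\to\overline{X}$ be the canonical isometric embedding $\mathrm{j}(x)(\phi)=\langle x,\phi\rangle$. Then $$\lambda_n(\mathrm{j}(A),\overline{X})=\Lambda_n(A,X).$$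
   Context: $B(Y)$ denotes the closed unit ball of a Banach space $Y$, $X^{\ast}$ and $X^{\ast\ast}$ are the dual and bidual of $X$, and $\mathrm{diam}(A,X)=\sup\{\|x-y\|_X: x,y\in A\}$. $\widehat{X}$ is the Banach space of all bounded functions $f:B(X^{\ast})\to\mathbb{R}$ with norm $\|f\|_{\widehat{X}}=\sup_{\phi\in B(X^{\ast})}|f(\phi)|$. Each element of $X^{\ast\ast}$ is regarded as an element of $\widehat{X}$ by restricting it to $B(X^{\ast})$; "$c_k\in X^{\ast\ast}$" means that $c_k$ is such a restriction. Each $x\in X$ is regarded as the function $\phi\mapsto\langle x,\phi\rangle$. $\mathrm{lin}(A)$ is the linear span of $A$, regarded as a Banach space with unit ball $A$; for $\phi\in X^{\ast}$ one has $\|\phi\|_{(\mathrm{lin}(A))^{\ast}}=\sup\{|\langle x,\phi\rangle|: x\in A\}$. Gelfand $n$-width: $d^n(A,X)=\inf_{L^n}\sup_{x\in A\cap L^n}\|x\|_X$, the infimum over all closed subspaces $L^n\subset X$ of codimension at most $n$. Linear $n$-width: for a Banach space $Y$ and $D\subset Y$, $\lambda_n(D,Y)=\inf_{P_n}\sup_{y\in D}\|y-P_ny\|_Y$, the infimum over all bounded linear operators $P_n:Y\to Y$ of rank at most $n$. Absolute linear $n$-width: $\Lambda_n(A,X)=\inf\lambda_n(\mathrm{j}(A),\widetilde{X})$, the infimum over all isometric extensions of $X$, i.e. all Banach spaces $\widetilde{X}$ and linear isometries (into) $\mathrm{j}:X\to\widetilde{X}$. *)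

theory Defs
  imports "HOL-Analysis.Analysis" "HOL-Library.Function_Algebras"
begin

instantiation "fun" :: (type, real_vector) real_vector
begin

definition scaleR_fun :: "real \<Rightarrow> ('a \<Rightarrow> 'b) \<Rightarrow> 'a \<Rightarrow> 'b"
  where "scaleR_fun r f = (\<lambda>x. r *\<^sub>R f x)"

instance
  by standard (simp_all add: scaleR_fun_def fun_eq_iff scaleR_add_right scaleR_add_left)

end

text \<open>
  The ambient type supplies only the linear operations. The norm is an arbitrary function whose
  values outside the carrier are irrelevant. Thus one ambient type carries many Banach spaces.
\<close>

locale banach_on =
  fixes S :: "'u::real_vector set" and N :: "'u \<Rightarrow> real"
  assumes subspace: "subspace S"
    and norm_eq_zero_iff: "x \<in> S \<Longrightarrow> N x = 0 \<longleftrightarrow> x = 0"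
    and norm_triangle: "x \<in> S \<Longrightarrow> y \<in> S \<Longrightarrow> N (x + y) \<le> N x + N y"
    and norm_scaleR: "x \<in> S \<Longrightarrow> N (r *\<^sub>R x) = \<bar>r\<bar> * N x"
    and complete: "(\<And>i::nat. s i \<in> S) \<Longrightarrow>
      (\<And>e. e > 0 \<Longrightarrow> \<exists>M. \<forall>i\<ge>M. \<forall>j\<ge>M. N (s i - s j) < e) \<Longrightarrow>
      \<exists>x\<in>S. (\<lambda>i. N (s i - x)) \<longlonglongrightarrow> 0"

definition isometric_extension ::
    "'u::real_vector set \<Rightarrow> ('u \<Rightarrow> real) \<Rightarrow> ('a::banach \<Rightarrow> 'u) \<Rightarrow> bool"
  where "isometric_extension S N j \<longleftrightarrow>
    banach_on S N \<and> linear j \<and> (\<forall>x. j x \<in> S \<and> N (j x) = norm x)"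

lemma isometric_extension_banach:
  fixes j :: "'a::banach \<Rightarrow> 'b::banach"
  assumes "linear j" and "\<And>x. norm (j x) = norm x"
  shows "isometric_extension UNIV norm j"
proof -
  have "banach_on (UNIV :: 'b set) norm"
  proof
    fix s :: "nat \<Rightarrow> 'b"
    assume *: "\<And>e::real. e > 0 \<Longrightarrow> \<exists>M. \<forall>i\<ge>M. \<forall>j\<ge>M. norm (s i - s j) < e"
    have "Cauchy s"
      unfolding Cauchy_def dist_norm using * by blast
    then obtain x where "s \<longlonglongrightarrow> x"
      using Cauchy_convergent_iff convergent_def by blast
    then have "(\<lambda>i. norm (s i - x)) \<longlonglongrightarrow> 0"
      using LIM_zero tendsto_norm_zero by blast
    then show "\<exists>x\<in>UNIV. (\<lambda>i. norm (s i - x)) \<longlonglongrightarrow> 0"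
      by blast
  qed (auto simp: norm_triangle_ineq)
  then show ?thesis
    using assms by (simp add: isometric_extension_def)
qed

lemma isometric_extension_fst:
  fixes S :: "'u::real_vector set" and j :: "'a::banach \<Rightarrow> 'u"
  assumes "isometric_extension S N j"
  shows "isometric_extension (S \<times> {0 :: 'v::real_vector}) (N \<circ> fst) (\<lambda>x. (j x, 0))"
proof -
  interpret banach_on S N
    using assms by (simp add: isometric_extension_def)
  have "banach_on (S \<times> {0 :: 'v}) (N \<circ> fst)"
  proof
    show "subspace (S \<times> {0 :: 'v})"
      using subspace by (intro subspace_Times) auto
  next
    fix s :: "nat \<Rightarrow> 'u \<times> 'v"
    assume s: "\<And>i. s i \<in> S \<times> {0}"
      and *: "\<And>e::real. e > 0 \<Longrightarrow> \<exists>M. \<forall>i\<ge>M. \<forall>j\<ge>M. (N \<circ> fst) (s i - s j) < e"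
    have "\<exists>x\<in>S. (\<lambda>i. N (fst (s i) - x)) \<longlonglongrightarrow> 0"
    proof (rule complete)
      show "fst (s i) \<in> S" for i
        using s[of i] by auto
      show "\<exists>M. \<forall>i\<ge>M. \<forall>j\<ge>M. N (fst (s i) - fst (s j)) < e" if "e > 0" for e :: real
        using *[OF that] by simp
    qed
    then show "\<exists>x\<in>S \<times> {0}. (\<lambda>i. (N \<circ> fst) (s i - x)) \<longlonglongrightarrow> 0"
      by auto
  qed (auto simp: norm_eq_zero_iff norm_triangle norm_scaleR zero_prod_def)
  then show ?thesis
    using assms
    by (auto simp: isometric_extension_def linear_iff scaleR_prod_def)
qed

text \<open>
  The library constant \<^const>\<open>dim\<close> is 0 on infinite-dimensional spaces, so rank and
  codimension are bounded through spanning sets. Widths are extended nonnegative reals, so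
  that suprema of empty or unbounded sets of norms are 0 and infinity.
\<close>

definition codim_le :: "nat \<Rightarrow> 'a::real_vector set \<Rightarrow> bool"
  where "codim_le n L \<longleftrightarrow> (\<exists>B. finite B \<and> card B \<le> n \<and> span (L \<union> B) = UNIV)"

definition gelfand_width :: "nat \<Rightarrow> 'a::banach set \<Rightarrow> ennreal"
  where "gelfand_width n A =
    (INF L \<in> {L. subspace L \<and> closed L \<and> codim_le n L}. SUP x \<in> A \<inter> L. ennreal (norm x))"

definition finite_rank_operators ::
    "nat \<Rightarrow> 'u::real_vector set \<Rightarrow> ('u \<Rightarrow> real) \<Rightarrow> ('u \<Rightarrow> 'u) set"
  where "finite_rank_operators n S N = {P.
    P ` S \<subseteq> S \<and>
    (\<forall>x\<in>S. \<forall>y\<in>S. P (x + y) = P x + P y) \<and>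
    (\<forall>r. \<forall>x\<in>S. P (r *\<^sub>R x) = r *\<^sub>R P x) \<and>
    (\<exists>K. \<forall>x\<in>S. N (P x) \<le> K * N x) \<and>
    (\<exists>B. finite B \<and> card B \<le> n \<and> P ` S \<subseteq> span B)}"

definition linear_width ::
    "nat \<Rightarrow> 'u::real_vector set \<Rightarrow> 'u set \<Rightarrow> ('u \<Rightarrow> real) \<Rightarrow> ennreal"
  where "linear_width n D S N =
    (INF P \<in> finite_rank_operators n S N. SUP y \<in> D. ennreal (N (y - P y)))"

text \<open>
  HOL cannot quantify over all Banach spaces in one formula. The infimum below runs over the
  isometric extensions carried by subspaces of a given ambient type. To speak about all Banach
  spaces, use an ambient type \<open>'e \<times> 'v\<close> with a type variable \<open>'e\<close>: by
  \<open>isometric_extension_banach\<close> and \<open>isometric_extension_fst\<close>, the infimum then covers every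
  extension on \<open>'e\<close>, and the factor \<open>'v\<close> makes the type large enough for a particular extension.
\<close>

definition absolute_linear_width ::
    "'u::real_vector itself \<Rightarrow> nat \<Rightarrow> 'a::banach set \<Rightarrow> ennreal"
  where "absolute_linear_width _ n A =
    (INF (S, N, j) \<in> {(S :: 'u set, N, j). isometric_extension S N j}.
      linear_width n (j ` A) S N)"

type_synonym 'a dual = "'a \<Rightarrow>\<^sub>L real"

type_synonym 'a dual_fun = "'a dual \<Rightarrow> real"

text \<open>
  A function on the closed dual unit ball is represented by its extension by zero to the
  whole dual.
\<close>

definition restrict_ball :: "('a::banach dual \<Rightarrow> real) \<Rightarrow> 'a dual_fun"
  where "restrict_ball f = (\<lambda>\<phi>. if \<phi> \<in> cball 0 1 then f \<phi> else 0)"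

definition hat_space :: "'a::banach dual_fun set"
  where "hat_space = {f. bounded (f ` cball 0 1) \<and> (\<forall>\<phi>. \<phi> \<notin> cball 0 1 \<longrightarrow> f \<phi> = 0)}"

definition hat_norm :: "'a::banach dual_fun \<Rightarrow> real"
  where "hat_norm f = (SUP \<phi> \<in> cball 0 1. \<bar>f \<phi>\<bar>)"

definition canonical_embedding :: "'a::banach \<Rightarrow> 'a dual_fun"
  where "canonical_embedding x = restrict_ball (\<lambda>\<phi>. blinfun_apply \<phi> x)"

definition bidual_space :: "'a::banach dual_fun set"
  where "bidual_space = range (\<lambda>\<psi> :: 'a dual dual. restrict_ball (blinfun_apply \<psi>))"

definition bracket :: "'a::banach dual_fun \<Rightarrow> 'a dual_fun"
  where "bracket c = (if c \<in> bidual_space then 0 else c)"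

definition bar_space :: "nat \<Rightarrow> (nat \<Rightarrow> 'a::banach dual_fun) \<Rightarrow> 'a dual_fun set"
  where "bar_space n c = span (bidual_space \<union> (\<lambda>k. bracket (c k)) ` {1..n})"

text \<open>The norm of a functional in the dual of the space spanned by A with unit ball A.\<close>

definition lin_dual_norm :: "'a::banach set \<Rightarrow> 'a dual \<Rightarrow> ennreal"
  where "lin_dual_norm A \<phi> = (SUP x \<in> A. ennreal \<bar>blinfun_apply \<phi> x\<bar>)"

end

theory Submission
  imports Defs
begin

text \<open>
  Both widths equal the Gelfand width of A. In any isometric extension, the kernel of a rank-n
  operator meets X in a closed subspace of codimension at most n, and there the operator's error
  at a point is the norm of the point; so no extension does better than the Gelfand width.
  Conversely, the distance of a functional from the span of the given functionals, in the dual of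
  lin A, is its supremum over the part of A on which they all vanish, which for functionals in the
  unit ball is at most the Gelfand width. Hence x minus the sum of the values of the given
  functionals at x times the best approximation coefficients has norm at most that width.
\<close>

text \<open>The best approximation coefficients need not depend linearly on the functional, so in
  general they are not elements of the bidual. Among bounded functions on the dual ball this is
  harmless: the error at \<open>x\<close> is the function sending \<psi> to \<psi>(x) minus the sum
  of \<open>c k \<psi>\<close> times the value of \<open>\<phi> k\<close> at \<open>x\<close>. It is
  linear in \<open>x\<close> whatever the \<open>c k\<close> are, and its suprema over \<psi> and
  over \<open>A\<close> may be taken in either order, which brings in distances in the dual of lin
  A. To make this an admissible competitor, the operator must act on all of
  \<open>bar_space n c\<close>, so every given functional has to be extended from X; and that space
  must be complete, which holds because only finitely many vectors are adjoined to the complete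
  bidual. That X embeds isometrically is a Hahn-Banach statement, derived here from Zorn's lemma for
  sublinear functionals. The bound on the distances comes from convex combinations lying in a
  kernel, by induction on the number of functionals.\<close>

subsection \<open>Minimal sublinear functionals\<close>

definition sublinear :: "('a::real_vector \<Rightarrow> real) \<Rightarrow> bool"
  where "sublinear p \<longleftrightarrow>
    (\<forall>x y. p (x + y) \<le> p x + p y) \<and> (\<forall>r\<ge>0. \<forall>x. p (r *\<^sub>R x) = r * p x)"

lemma sublinear_add: "sublinear p \<Longrightarrow> p (x + y) \<le> p x + p y"
  by (simp add: sublinear_def)

lemma sublinear_scaleR: "sublinear p \<Longrightarrow> 0 \<le> r \<Longrightarrow> p (r *\<^sub>R x) = r * p x"
  by (simp add: sublinear_def)

lemma sublinear_zero: "sublinear p \<Longrightarrow> p 0 = 0"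
  using sublinear_scaleR[of p 0 0] by simp

lemma sublinear_neg_le: "sublinear p \<Longrightarrow> - p (- x) \<le> p x"
  using sublinear_add[of p x "- x"] by (simp add: sublinear_zero)

text \<open>One inequality for positive factors suffices, since applying it to
  \<open>inverse r\<close> and \<open>r *\<^sub>R x\<close> gives the other one.\<close>

lemma sublinearI:
  assumes "\<And>x y. p (x + y) \<le> p x + p y" and "p 0 = 0"
    and le: "\<And>r x. 0 < r \<Longrightarrow> p (r *\<^sub>R x) \<le> r * p x"
  shows "sublinear p"
  unfolding sublinear_def
proof (intro conjI allI impI)
  fix r :: real and x
  assume "0 \<le> r"
  show "p (r *\<^sub>R x) = r * p x"
  proof (cases "r = 0")
    case False
    with \<open>0 \<le> r\<close> have "0 < r" by simp
    then have "r * p x \<le> p (r *\<^sub>R x)"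
      using le[of "inverse r" "r *\<^sub>R x"] by (simp add: field_simps)
    then show ?thesis
      using le[OF \<open>0 < r\<close>, of x] by simp
  qed (simp add: assms)
qed (rule assms)

text \<open>Near-optimal members at \<open>x\<close> and at \<open>y\<close> may differ;
  directedness replaces them by a common lower member, whose subadditivity then compares the three
  infima.\<close>

lemma sublinear_INF:
  assumes "C \<noteq> {}" and "\<And>q. q \<in> C \<Longrightarrow> sublinear q"
    and bdd: "\<And>x. bdd_below ((\<lambda>q. q x) ` C)"
    and dir: "\<And>q q'. q \<in> C \<Longrightarrow> q' \<in> C \<Longrightarrow> \<exists>q''\<in>C. q'' \<le> q \<and> q'' \<le> q'"
  shows "sublinear (\<lambda>x. INF q\<in>C. q x)"
proof (rule sublinearI)
  fix x y
  have "(INF q\<in>C. q (x + y)) - q x \<le> q' y" if q: "q \<in> C" "q' \<in> C" for q q'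
  proof -
    obtain q'' where q'': "q'' \<in> C" "q'' \<le> q" "q'' \<le> q'"
      using dir q by blast
    have "(INF q\<in>C. q (x + y)) \<le> q'' (x + y)"
      using bdd q'' by (intro cINF_lower)
    also have "\<dots> \<le> q'' x + q'' y"
      using assms(2) q'' by (intro sublinear_add)
    also have "\<dots> \<le> q x + q' y"
      using q'' by (intro add_mono) (auto simp: le_fun_def)
    finally show ?thesis by simp
  qed
  then have "(INF q\<in>C. q (x + y)) - q x \<le> (INF q\<in>C. q y)" if "q \<in> C" for q
    using that \<open>C \<noteq> {}\<close> by (intro cINF_greatest)
  then have "(INF q\<in>C. q (x + y)) - (INF q\<in>C. q y) \<le> (INF q\<in>C. q x)"
    using \<open>C \<noteq> {}\<close> by (intro cINF_greatest) (auto simp: algebra_simps)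
  then show "(INF q\<in>C. q (x + y)) \<le> (INF q\<in>C. q x) + (INF q\<in>C. q y)"
    by simp
next
  have "(\<lambda>q. q 0) ` C = {0}"
    using assms(1,2) sublinear_zero by fastforce
  then show "(INF q\<in>C. q 0) = 0"
    by simp
next
  fix r :: real and x
  assume "0 < r"
  have "(INF q\<in>C. q (r *\<^sub>R x)) / r \<le> q x" if "q \<in> C" for q
  proof -
    have "(INF q\<in>C. q (r *\<^sub>R x)) \<le> r * q x"
      using cINF_lower[OF bdd that, of "r *\<^sub>R x"] sublinear_scaleR[OF assms(2)[OF that], of r x]
        \<open>0 < r\<close> by simp
    then show ?thesis
      using \<open>0 < r\<close> by (simp add: field_simps)
  qed
  then have "(INF q\<in>C. q (r *\<^sub>R x)) / r \<le> (INF q\<in>C. q x)"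
    using \<open>C \<noteq> {}\<close> by (intro cINF_greatest)
  then show "(INF q\<in>C. q (r *\<^sub>R x)) \<le> r * (INF q\<in>C. q x)"
    using \<open>0 < r\<close> by (simp add: field_simps)
qed

text \<open>The auxiliary functional of the Hahn-Banach argument: it pushes \<open>p\<close> down as
  far as linearity along the ray of \<open>x\<close> demands. Taking \<open>t = 1\<close> shows that
  a minimal functional is superadditive; taking in addition \<open>y = - x\<close> gives
  \<open>q (- x) \<le> - p x\<close>, which pins down the value at \<open>x\<close>.\<close>

lemma sublinear_directional_minorant:
  assumes p: "sublinear p"
  obtains q where "sublinear q" and "q \<le> p" and "\<And>y t. 0 \<le> t \<Longrightarrow> q y \<le> p (y + t *\<^sub>R x) - t * p x"
proof -
  define f where "f y t = p (y + t *\<^sub>R x) - t * p x" for y t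
  define q where "q y = (INF t\<in>{0..}. f y t)" for y
  \<comment> \<open>A lower bound independent of \<open>t\<close>, so that the real infimum
    \<open>q y\<close> is meaningful. It comes from splitting \<open>t *\<^sub>R x\<close> as
    \<open>(y + t *\<^sub>R x) + (- y)\<close>.\<close>
  have lower: "- p (- y) \<le> f y t" if "0 \<le> t" for y t
    using sublinear_add[OF p, of "y + t *\<^sub>R x" "- y"] sublinear_scaleR[OF p that]
    by (simp add: f_def)
  have bdd: "bdd_below (f y ` {0..})" for y
    using lower by (intro bdd_belowI[of _ "- p (- y)"]) auto
  have q_le: "q y \<le> f y t" if "0 \<le> t" for y t
    unfolding q_def using bdd that by (intro cINF_lower) auto
  have q_ge: "u \<le> q y" if "\<And>t. 0 \<le> t \<Longrightarrow> u \<le> f y t" for u y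
    unfolding q_def using that by (intro cINF_greatest) auto
  have "sublinear q"
  proof (rule sublinearI)
    fix y z
    have "q (y + z) - f y s \<le> f z t" if "0 \<le> s" "0 \<le> t" for s t
      using q_le[of "s + t" "y + z"] that sublinear_add[OF p, of "y + s *\<^sub>R x" "z + t *\<^sub>R x"]
      by (simp add: f_def algebra_simps)
    then have "q (y + z) - f y s \<le> q z" if "0 \<le> s" for s
      using that by (intro q_ge)
    then have "q (y + z) - q z \<le> q y"
      by (intro q_ge) (simp add: algebra_simps)
    then show "q (y + z) \<le> q y + q z"
      by simp
  next
    have "f 0 t = 0" if "0 \<le> t" for t
      using that by (simp add: f_def sublinear_scaleR[OF p])
    then show "q 0 = 0"
      using q_le[of 0 0] q_ge[of 0 0] by fastforce
  next
    fix r :: real and y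
    assume "0 < r"
    have "q (r *\<^sub>R y) / r \<le> f y t" if "0 \<le> t" for t
    proof -
      have "q (r *\<^sub>R y) \<le> f (r *\<^sub>R y) (r * t)"
        using that \<open>0 < r\<close> by (intro q_le) simp
      also have "\<dots> = r * f y t"
        using sublinear_scaleR[OF p, of r "y + t *\<^sub>R x"] \<open>0 < r\<close>
        by (simp add: f_def algebra_simps)
      finally show ?thesis
        using \<open>0 < r\<close> by (simp add: field_simps)
    qed
    then have "q (r *\<^sub>R y) / r \<le> q y"
      by (rule q_ge)
    then show "q (r *\<^sub>R y) \<le> r * q y"
      using \<open>0 < r\<close> by (simp add: field_simps)
  qed
  moreover have "q \<le> p"
    using q_le[of 0] by (auto simp: le_fun_def f_def)
  ultimately show ?thesis
    using that q_le unfolding f_def by blast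
qed

text \<open>Zorn's lemma for the reversed pointwise order. A nonempty chain has its pointwise
  infimum as lower bound, which is finite because every sublinear \<open>q \<le> p\<close> satisfies
  \<open>- p (- x) \<le> - q (- x) \<le> q x\<close>.\<close>

lemma minimal_sublinear_exists:
  assumes p: "sublinear p"
  obtains q where "sublinear q" and "q \<le> p" and "\<And>q'. sublinear q' \<Longrightarrow> q' \<le> q \<Longrightarrow> q' = q"
proof -
  define Q where "Q = {q. sublinear q \<and> q \<le> p}"
  have "\<exists>m\<in>Q. \<forall>q\<in>Q. q \<le> m \<longrightarrow> q = m"
  proof (rule predicate_Zorn)
    show "partial_order_on Q (relation_of (\<lambda>a b. b \<le> a) Q)"
      by (rule partial_order_on_relation_ofI) auto
  next
    fix C
    assume "C \<in> Chains (relation_of (\<lambda>a b. b \<le> a) Q)"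
    then have C: "C \<subseteq> Q" and chain: "\<And>q q'. q \<in> C \<Longrightarrow> q' \<in> C \<Longrightarrow> q \<le> q' \<or> q' \<le> q"
      by (auto simp: Chains_def relation_of_def)
    show "\<exists>u\<in>Q. \<forall>a\<in>C. u \<le> a"
    proof (cases "C = {}")
      case True
      then show ?thesis using p by (auto simp: Q_def)
    next
      case False
      have bdd: "bdd_below ((\<lambda>q. q x) ` C)" for x
      proof (rule bdd_belowI)
        fix z
        assume "z \<in> (\<lambda>q. q x) ` C"
        then obtain q where q: "sublinear q" "q \<le> p" "z = q x"
          using C by (auto simp: Q_def)
        then show "- p (- x) \<le> z"
          using sublinear_neg_le[of q x] le_funD[of q p "- x"] by simp
      qed
      define u where "u x = (INF q\<in>C. q x)" for x
      have le: "u \<le> q" if "q \<in> C" for q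
        unfolding le_fun_def u_def using that bdd by (auto intro: cINF_lower)
      have "sublinear u"
        unfolding u_def
      proof (rule sublinear_INF)
        show "\<exists>q''\<in>C. q'' \<le> q \<and> q'' \<le> q'" if "q \<in> C" "q' \<in> C" for q q'
          using chain[OF that] that by blast
      qed (use C bdd False in \<open>auto simp: Q_def\<close>)
      moreover have "u \<le> p"
        using False C le by (force simp: Q_def)
      ultimately show ?thesis
        using le by (auto simp: Q_def)
    qed
  qed
  then obtain m where m: "m \<in> Q" "\<And>q. q \<in> Q \<Longrightarrow> q \<le> m \<Longrightarrow> q = m"
    by blast
  show ?thesis
  proof
    show "sublinear m" "m \<le> p"
      using m by (auto simp: Q_def)
    show "q' = m" if "sublinear q'" "q' \<le> m" for q'
      using that m by (auto simp: Q_def)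
  qed
qed

text \<open>By minimality the directional minorant of \<open>q\<close> along any \<open>x\<close> is
  \<open>q\<close> itself; its defining inequality at \<open>t = 1\<close> is superadditivity, and
  oddness and homogeneity for negative factors follow.\<close>

lemma minimal_sublinear_linear:
  assumes q: "sublinear q" and min: "\<And>q'. sublinear q' \<Longrightarrow> q' \<le> q \<Longrightarrow> q' = q"
  shows "linear q"
proof -
  have "q y \<le> q (y + x) - q x" for x y
  proof -
    obtain q' where "sublinear q'" "q' \<le> q" "\<And>y t. 0 \<le> t \<Longrightarrow> q' y \<le> q (y + t *\<^sub>R x) - t * q x"
      using sublinear_directional_minorant[OF q] by blast
    then show ?thesis
      using min[of q'] by (metis mult_1 scaleR_one zero_le_one)
  qed
  then have add: "q (x + y) = q x + q y" for x y
    using sublinear_add[OF q, of x y] by (simp add: add.commute antisym le_diff_eq)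
  have neg: "q (- x) = - q x" for x
    using add[of x "- x"] by (simp add: sublinear_zero[OF q])
  show ?thesis
  proof (rule linearI)
    fix r x
    show "q (r *\<^sub>R x) = r *\<^sub>R q x"
    proof (cases "0 \<le> r")
      case True
      then show ?thesis by (simp add: sublinear_scaleR[OF q])
    next
      case False
      then show ?thesis
        using sublinear_scaleR[OF q, of "- r" x] neg[of "r *\<^sub>R x"] by simp
    qed
  qed (rule add)
qed

text \<open>The norm is first lowered along \<open>x\<close> and only then minimised: the first step
  forces every smaller functional to be at most \<open>- norm x\<close> at \<open>- x\<close>, the
  second makes it linear.\<close>

lemma norming_functional_exists:
  fixes x :: "'a::real_normed_vector"
  obtains f :: "'a \<Rightarrow>\<^sub>L real" where "norm f \<le> 1" and "blinfun_apply f x = norm x"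
proof -
  have "sublinear (norm :: 'a \<Rightarrow> real)"
    by (simp add: sublinear_def norm_triangle_ineq)
  then obtain p where p: "sublinear p" "p \<le> norm"
    and p_dir: "\<And>y t. 0 \<le> t \<Longrightarrow> p y \<le> norm (y + t *\<^sub>R x) - t * norm x"
    using sublinear_directional_minorant by blast
  obtain q where q: "sublinear q" "q \<le> p" "\<And>q'. sublinear q' \<Longrightarrow> q' \<le> q \<Longrightarrow> q' = q"
    using minimal_sublinear_exists[OF p(1)] by blast
  have lin: "linear q"
    using q by (intro minimal_sublinear_linear)
  have le: "q y \<le> norm y" for y
    using p q by (meson le_funD order_trans)
  have abs_le: "\<bar>q y\<bar> \<le> norm y" for y
    using le[of y] le[of "- y"] linear_neg[OF lin, of y] by simp
  have "bounded_linear q"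
    using abs_le lin by (intro bounded_linear_intro[where K=1])
      (auto simp: linear_add linear_scale)
  then have app: "blinfun_apply (Blinfun q) = q"
    by (rule bounded_linear_Blinfun_apply)
  have "q (- x) \<le> - norm x"
    using le_funD[OF q(2), of "- x"] p_dir[of 1 "- x"] by simp
  then have "q x = norm x"
    using le[of x] linear_neg[OF lin, of x] by simp
  then show ?thesis
    using app abs_le by (intro that[of "Blinfun q"] norm_blinfun_bound) auto
qed

subsection \<open>Approximation by functionals bounded on common kernels\<close>

text \<open>For points with \<open>0 < g x\<close> the claim says that \<open>a\<close> lies between
  \<open>(f x - M) / g x\<close> and \<open>(M + f x) / g x\<close>. Such an \<open>a\<close> exists
  once every lower bound is below every upper bound; symmetry of \<open>A\<close> settles the points
  with \<open>g x < 0\<close> and turns the one-sided bound on the kernel into a two-sided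
  one.\<close>

lemma approx_by_functional_of_bounded_on_kernel:
  fixes f g :: "'a::real_vector \<Rightarrow> real"
  assumes "convex A" and sym: "\<And>x. x \<in> A \<Longrightarrow> - x \<in> A" and "linear f" and "linear g"
    and M: "\<And>x. x \<in> A \<Longrightarrow> g x = 0 \<Longrightarrow> f x \<le> M" and "0 \<le> M"
  obtains a where "\<And>x. x \<in> A \<Longrightarrow> \<bar>f x - a * g x\<bar> \<le> M"
proof (cases "\<exists>x\<in>A. 0 < g x")
  case False
  have "g x = 0" if "x \<in> A" for x
  proof -
    have "\<not> 0 < g x" "\<not> 0 < g (- x)"
      using False that sym by blast+
    then show ?thesis
      using linear_neg[OF \<open>linear g\<close>, of x] by simp
  qed
  then have "\<bar>f x\<bar> \<le> M" if "x \<in> A" for x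
    using M[OF that] M[OF sym[OF that]] sym[OF that] that linear_neg[OF \<open>linear f\<close>, of x] by simp
  then show ?thesis
    using that[of 0] by simp
next
  case True
  define P where "P = {x \<in> A. 0 < g x}"
  have sep: "(f x - M) / g x \<le> (M + f y) / g y" if "x \<in> P" "y \<in> P" for x y
  proof -
    from that have pos: "0 < g x" "0 < g y" and A: "x \<in> A" "y \<in> A"
      by (auto simp: P_def)
    define s where "s = g x + g y"
    have "0 < s" using pos by (simp add: s_def)
    \<comment> \<open>The convex combination of \<open>x\<close> and \<open>- y\<close> on which
      \<open>g\<close> vanishes; the bound \<open>f z \<le> M\<close>, multiplied by
      \<open>s\<close>, is the required inequality between the two quotients.\<close>
    define z where "z = (g y / s) *\<^sub>R x + (g x / s) *\<^sub>R (- y)"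
    have "g y / s + g x / s = 1"
      using \<open>0 < s\<close> by (simp add: s_def add.commute flip: add_divide_distrib)
    then have "z \<in> A"
      unfolding z_def using pos A sym \<open>0 < s\<close> by (intro convexD[OF \<open>convex A\<close>]) auto
    moreover have "g z = 0"
      by (simp add: z_def linear_add[OF \<open>linear g\<close>] linear_scale[OF \<open>linear g\<close>]
          linear_diff[OF \<open>linear g\<close>])
    ultimately have "f z \<le> M" by (rule M)
    moreover have "f z = (g y * f x - g x * f y) / s"
      by (simp add: z_def linear_add[OF \<open>linear f\<close>] linear_scale[OF \<open>linear f\<close>]
          linear_diff[OF \<open>linear f\<close>] diff_divide_distrib)
    ultimately have "g y * f x - g x * f y \<le> M * (g x + g y)"
      using \<open>0 < s\<close> by (simp add: s_def field_simps)
    then show ?thesis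
      using pos by (simp add: field_simps)
  qed
  have "P \<noteq> {}"
    using True by (auto simp: P_def)
  then obtain y0 where "y0 \<in> P" by blast
  define a where "a = (SUP x\<in>P. (f x - M) / g x)"
  have "bdd_above ((\<lambda>x. (f x - M) / g x) ` P)"
    using sep \<open>y0 \<in> P\<close> by (intro bdd_aboveI[of _ "(M + f y0) / g y0"]) auto
  then have lower: "(f x - M) / g x \<le> a" if "x \<in> P" for x
    unfolding a_def using that by (intro cSUP_upper)
  have upper: "a \<le> (M + f y) / g y" if "y \<in> P" for y
    unfolding a_def using that sep \<open>P \<noteq> {}\<close> by (intro cSUP_least)
  have pos_case: "\<bar>f x - a * g x\<bar> \<le> M" if "x \<in> P" for x
    using lower[OF that] upper[OF that] that by (auto simp: P_def field_simps abs_le_iff)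
  have "\<bar>f x - a * g x\<bar> \<le> M" if "x \<in> A" for x
  proof (cases "g x" "0 :: real" rule: linorder_cases)
    case less
    then have "- x \<in> P"
      using that sym by (simp add: P_def linear_neg[OF \<open>linear g\<close>])
    then show ?thesis
      using pos_case[of "- x"] by (simp add: linear_neg[OF \<open>linear g\<close>] linear_neg[OF \<open>linear f\<close>])
  next
    case equal
    then show ?thesis
      using M[OF that] M[OF sym[OF that]]
      by (simp add: linear_neg[OF \<open>linear g\<close>] linear_neg[OF \<open>linear f\<close>])
  next
    case greater
    then show ?thesis using that pos_case by (simp add: P_def)
  qed
  then show ?thesis
    using that by blast
qed

text \<open>Intersecting \<open>A\<close> with the kernel of the last functional keeps it convex and
  symmetric, so the induction hypothesis provides the first \<open>n\<close> coefficients there. The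
  remainder is then bounded by \<open>M\<close> on that kernel, and the case of a single functional
  supplies the last coefficient with the same \<open>M\<close>.\<close>

lemma approx_by_functionals_of_bounded_on_kernels:
  fixes f :: "'a::real_vector \<Rightarrow> real" and g :: "nat \<Rightarrow> 'a \<Rightarrow> real"
  assumes "convex A" and "\<And>x. x \<in> A \<Longrightarrow> - x \<in> A" and "linear f"
    and "\<And>k. linear (g k)"
    and "\<And>x. x \<in> A \<Longrightarrow> \<forall>k\<in>{1..n}. g k x = 0 \<Longrightarrow> f x \<le> M" and "0 \<le> M"
  shows "\<exists>a. \<forall>x\<in>A. \<bar>f x - (\<Sum>k=1..n. a k * g k x)\<bar> \<le> M"
  using assms
proof (induction n arbitrary: A)
  case 0
  have "\<bar>f x\<bar> \<le> M" if "x \<in> A" for x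
    using 0(5)[of x] 0(5)[of "- x"] 0(2)[OF that] that linear_neg[OF 0(3), of x] by simp
  then show ?case by simp
next
  case (Suc n)
  define A' where "A' = {x \<in> A. g (Suc n) x = 0}"
  have "A' = A \<inter> g (Suc n) -` {0}"
    by (auto simp: A'_def)
  then have "convex A'"
    using \<open>convex A\<close> \<open>linear (g (Suc n))\<close> by (simp add: convex_Int convex_linear_vimage)
  then have "\<exists>a. \<forall>x\<in>A'. \<bar>f x - (\<Sum>k=1..n. a k * g k x)\<bar> \<le> M"
  proof (rule Suc.IH)
    show "f x \<le> M" if "x \<in> A'" "\<forall>k\<in>{1..n}. g k x = 0" for x
      using that by (intro Suc.prems) (auto simp: A'_def atLeastAtMostSuc_conv)
  qed (use Suc.prems in \<open>auto simp: A'_def linear_neg\<close>)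
  then obtain a where a: "\<And>x. x \<in> A' \<Longrightarrow> \<bar>f x - (\<Sum>k=1..n. a k * g k x)\<bar> \<le> M"
    by blast
  have "linear (\<lambda>x. f x - (\<Sum>k=1..n. a k * g k x))"
    using linear_compose_scale_right[OF Suc.prems(4)]
    by (intro linear_compose_sub linear_compose_sum Suc.prems(3)) simp
  then obtain b where b: "\<And>x. x \<in> A \<Longrightarrow> \<bar>f x - (\<Sum>k=1..n. a k * g k x) - b * g (Suc n) x\<bar> \<le> M"
    using approx_by_functional_of_bounded_on_kernel[of A "\<lambda>x. f x - (\<Sum>k=1..n. a k * g k x)" "g (Suc n)" M]
      Suc.prems a by (auto simp: A'_def abs_le_iff)
  have "\<bar>f x - (\<Sum>k=1..Suc n. (a(Suc n := b)) k * g k x)\<bar> \<le> M" if "x \<in> A" for x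
  proof -
    have "(\<Sum>k=1..n. (a(Suc n := b)) k * g k x) = (\<Sum>k=1..n. a k * g k x)"
      by (rule sum.cong) auto
    then show ?thesis
      using b[OF that] by (simp add: algebra_simps)
  qed
  then show ?case by blast
qed

subsection \<open>Complete subspaces and finite-dimensional extensions\<close>

text \<open>The axioms of \<open>banach_on\<close> without completeness. The bounded functions serve
  only as a surrounding normed space; completeness is established for the subspaces that are
  used.\<close>

locale normed_on =
  fixes U :: "'u::real_vector set" and N :: "'u \<Rightarrow> real"
  assumes subspace: "subspace U"
    and norm_eq_zero_iff: "x \<in> U \<Longrightarrow> N x = 0 \<longleftrightarrow> x = 0"
    and norm_triangle: "x \<in> U \<Longrightarrow> y \<in> U \<Longrightarrow> N (x + y) \<le> N x + N y"
    and norm_scaleR: "x \<in> U \<Longrightarrow> N (r *\<^sub>R x) = \<bar>r\<bar> * N x"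
begin

lemma norm_zero: "N 0 = 0"
  using norm_eq_zero_iff[of 0] subspace_0[OF subspace] by simp

lemma norm_minus: "x \<in> U \<Longrightarrow> N (- x) = N x"
  using norm_scaleR[of x "- 1"] by simp

lemma norm_minus_commute: "x \<in> U \<Longrightarrow> y \<in> U \<Longrightarrow> N (x - y) = N (y - x)"
  using norm_minus[of "x - y"] subspace_diff[OF subspace] by simp

lemma norm_nonneg: "x \<in> U \<Longrightarrow> 0 \<le> N x"
  using norm_triangle[of x "- x"] subspace_neg[OF subspace, of x]
  by (simp add: norm_zero norm_minus)

lemma norm_triangle_diff: "x \<in> U \<Longrightarrow> y \<in> U \<Longrightarrow> N (x - y) \<le> N x + N y"
  using norm_triangle[of x "- y"] subspace_neg[OF subspace, of y] by (simp add: norm_minus)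

lemma norm_triangle_via: "x \<in> U \<Longrightarrow> y \<in> U \<Longrightarrow> z \<in> U \<Longrightarrow> N (x - z) \<le> N (x - y) + N (y - z)"
  using norm_triangle[of "x - y" "y - z"] subspace_diff[OF subspace] by simp

lemma norm_sum_le: "(\<And>i. i \<in> I \<Longrightarrow> f i \<in> U) \<Longrightarrow> N (\<Sum>i\<in>I. f i) \<le> (\<Sum>i\<in>I. N (f i))"
proof (induction I rule: infinite_finite_induct)
  case (insert i I)
  then have "N (f i + sum f I) \<le> N (f i) + N (sum f I)"
    by (intro norm_triangle subspace_sum[OF subspace]) auto
  with insert show ?case by fastforce
qed (auto simp: norm_zero)

lemma normed_on_subspace: "subspace T \<Longrightarrow> T \<subseteq> U \<Longrightarrow> normed_on T N"
  by standard (use norm_eq_zero_iff norm_triangle norm_scaleR in blast)+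

text \<open>If the distance were zero, elements of \<open>S\<close> approaching \<open>v\<close>
  would form a Cauchy sequence, whose limit in \<open>S\<close> would have to be
  \<open>v\<close>.\<close>

lemma dist_to_complete_subspace:
  assumes S: "banach_on S N" "S \<subseteq> U" and v: "v \<in> U" "v \<notin> S"
  obtains d where "0 < d" and "\<And>y. y \<in> S \<Longrightarrow> d \<le> N (v - y)"
proof -
  interpret S: banach_on S N by fact
  have "\<exists>d>0. \<forall>y\<in>S. d \<le> N (v - y)"
  proof (rule ccontr)
    assume "\<not> ?thesis"
    then have "\<exists>y\<in>S. N (v - y) < inverse (Suc i)" for i
      by (meson not_less of_nat_0_less_iff positive_imp_inverse_positive zero_less_Suc)
    then obtain y where y: "\<And>i. y i \<in> S" and small: "\<And>i. N (v - y i) < inverse (Suc i)"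
      by metis
    have yU: "y i \<in> U" for i
      using y S by blast
    have lim: "(\<lambda>i. N (v - y i)) \<longlonglongrightarrow> 0"
    proof (rule tendsto_sandwich)
      show "\<forall>\<^sub>F i in sequentially. 0 \<le> N (v - y i)"
        using subspace_diff[OF subspace v(1) yU] by (simp add: norm_nonneg)
      show "\<forall>\<^sub>F i in sequentially. N (v - y i) \<le> inverse (Suc i)"
        using small by (simp add: less_imp_le)
    qed (rule tendsto_const LIMSEQ_inverse_real_of_nat)+
    have "\<exists>x\<in>S. (\<lambda>i. N (y i - x)) \<longlonglongrightarrow> 0"
    proof (rule S.complete)
      fix e :: real
      assume "e > 0"
      then have "\<forall>\<^sub>F i in sequentially. N (v - y i) < e / 2"
        using lim by (intro order_tendstoD) auto
      then obtain M where M: "\<And>i. i \<ge> M \<Longrightarrow> N (v - y i) < e / 2"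
        by (auto simp: eventually_sequentially)
      have "N (y i - y j) < e" if "i \<ge> M" "j \<ge> M" for i j
        using norm_triangle_via[OF yU[of i] v(1) yU[of j]] norm_minus_commute[OF v(1) yU[of i]]
          M[OF that(1)] M[OF that(2)] by simp
      then show "\<exists>M. \<forall>i\<ge>M. \<forall>j\<ge>M. N (y i - y j) < e"
        by blast
    qed (rule y)
    then obtain x where x: "x \<in> S" "(\<lambda>i. N (y i - x)) \<longlonglongrightarrow> 0" by blast
    then have xU: "x \<in> U" using S by blast
    have "N (v - x) \<le> 0 + 0"
    proof (rule tendsto_lowerbound)
      show "(\<lambda>i. N (v - y i) + N (y i - x)) \<longlonglongrightarrow> 0 + 0"
        by (intro tendsto_add lim x)
      show "\<forall>\<^sub>F i in sequentially. N (v - x) \<le> N (v - y i) + N (y i - x)"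
        using norm_triangle_via[OF v(1) yU xU] by simp
    qed simp
    then have "v = x"
      using norm_eq_zero_iff[of "v - x"] norm_nonneg[of "v - x"] subspace_diff[OF subspace v(1) xU]
      by simp
    with x v show False by simp
  qed
  then show ?thesis
    using that by blast
qed

text \<open>The positive distance \<open>d\<close> from \<open>v\<close> to \<open>S\<close> makes
  the coefficient of \<open>v\<close> a Lipschitz function of the vector. Hence a Cauchy sequence
  splits into a Cauchy sequence of reals and one in \<open>S\<close>, and the two limits
  recombine.\<close>

lemma banach_on_span_insert:
  assumes S: "banach_on S N" "S \<subseteq> U" and v: "v \<in> U"
  shows "banach_on (span (insert v S)) N"
proof (cases "v \<in> S")
  case True
  then have "span (insert v S) = S"
    using banach_on.subspace[OF S(1)] by (simp add: insert_absorb span_eq_iff)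
  then show ?thesis using S by simp
next
  case False
  interpret S: banach_on S N by fact
  have span_S: "span S = S"
    using S.subspace by (simp add: span_eq_iff)
  obtain d where "0 < d" and d: "\<And>y. y \<in> S \<Longrightarrow> d \<le> N (v - y)"
    using dist_to_complete_subspace[OF S v False] by blast
  have coord: "\<bar>a\<bar> * d \<le> N (y + a *\<^sub>R v)" if "y \<in> S" for a y
  proof (cases "a = 0")
    case True
    then show ?thesis using that S by (auto simp: norm_nonneg)
  next
    case False
    define w where "w = (- inverse a) *\<^sub>R y"
    have "w \<in> S"
      unfolding w_def using that by (intro subspace_scale S.subspace)
    then have "v - w \<in> U"
      using S v by (intro subspace_diff[OF subspace]) auto
    have "y + a *\<^sub>R v = a *\<^sub>R (v - w)"
      using False by (simp add: w_def algebra_simps)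
    then have "N (y + a *\<^sub>R v) = \<bar>a\<bar> * N (v - w)"
      using norm_scaleR[OF \<open>v - w \<in> U\<close>] by simp
    then show ?thesis
      using d[OF \<open>w \<in> S\<close>] by (simp add: mult_left_mono)
  qed
  have sub: "span (insert v S) \<subseteq> U"
    using v S subspace by (intro span_minimal) auto
  interpret T: normed_on "span (insert v S)" N
    using sub by (intro normed_on_subspace subspace_span)
  show ?thesis
  proof
    fix s :: "nat \<Rightarrow> 'u"
    assume s: "\<And>i. s i \<in> span (insert v S)"
      and Cauchy: "\<And>e. e > 0 \<Longrightarrow> \<exists>M. \<forall>i\<ge>M. \<forall>j\<ge>M. N (s i - s j) < e"
    have "\<exists>a. s i - a *\<^sub>R v \<in> S" for i
      using s[of i] span_S by (simp add: span_breakdown_eq)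
    then obtain a where a: "\<And>i. s i - a i *\<^sub>R v \<in> S" by metis
    define y where "y i = s i - a i *\<^sub>R v" for i
    have y: "y i \<in> S" for i
      using a by (simp add: y_def)
    have sU: "s i - s j \<in> U" for i j
      using s sub subspace_diff[OF subspace] by blast
    have diff: "y i - y j + (a i - a j) *\<^sub>R v = s i - s j" for i j
      by (simp add: y_def algebra_simps)
    have a_le: "\<bar>a i - a j\<bar> * d \<le> N (s i - s j)" for i j
      using coord[OF subspace_diff[OF S.subspace y[of i] y[of j]], of "a i - a j"]
      unfolding diff .
    have "Cauchy a"
    proof (rule CauchyI)
      fix e :: real
      assume "0 < e"
      then obtain M where M: "\<forall>i\<ge>M. \<forall>j\<ge>M. N (s i - s j) < e * d"
        using Cauchy[of "e * d"] \<open>0 < d\<close> by auto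
      have "norm (a i - a j) < e" if "i \<ge> M" "j \<ge> M" for i j
      proof -
        have "\<bar>a i - a j\<bar> * d < e * d"
          using a_le[of i j] M that by (meson order_le_less_trans)
        then show ?thesis using \<open>0 < d\<close> by simp
      qed
      then show "\<exists>M. \<forall>i\<ge>M. \<forall>j\<ge>M. norm (a i - a j) < e" by blast
    qed
    then obtain b where b: "a \<longlonglongrightarrow> b"
      using Cauchy_convergent_iff convergent_def by blast
    have "N v \<ge> 0" using v by (rule norm_nonneg)
    have "\<exists>x\<in>S. (\<lambda>i. N (y i - x)) \<longlonglongrightarrow> 0"
    proof (rule S.complete)
      fix e :: real
      assume "e > 0"
      \<comment> \<open>Removing the component along \<open>v\<close> enlarges distances by at most
        the factor \<open>1 + N v / d\<close>.\<close>
      define e' where "e' = e / (1 + N v / d)"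
      have pos: "0 < 1 + N v / d"
        using \<open>N v \<ge> 0\<close> \<open>0 < d\<close> by (simp add: add_pos_nonneg)
      with \<open>e > 0\<close> have "0 < e'" by (simp add: e'_def)
      then obtain M where M: "\<forall>i\<ge>M. \<forall>j\<ge>M. N (s i - s j) < e'"
        using Cauchy by blast
      have "N (y i - y j) < e" if "i \<ge> M" "j \<ge> M" for i j
      proof -
        have "y i - y j = (s i - s j) - (a i - a j) *\<^sub>R v"
          by (simp add: y_def algebra_simps)
        then have "N (y i - y j) \<le> N (s i - s j) + \<bar>a i - a j\<bar> * N v"
          using norm_triangle_diff[OF sU subspace_scale[OF subspace v], of i j "a i - a j"]
            norm_scaleR[OF v] by simp
        also have "\<bar>a i - a j\<bar> \<le> N (s i - s j) / d"
          using a_le[of i j] \<open>0 < d\<close> by (simp add: field_simps)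
        then have "\<bar>a i - a j\<bar> * N v \<le> N (s i - s j) / d * N v"
          using \<open>N v \<ge> 0\<close> by (rule mult_right_mono)
        also have "N (s i - s j) + N (s i - s j) / d * N v = N (s i - s j) * (1 + N v / d)"
          by (simp add: algebra_simps)
        also have "\<dots> < e' * (1 + N v / d)"
          using M that pos by simp
        also have "\<dots> = e"
          using pos by (simp add: e'_def)
        finally show ?thesis by simp
      qed
      then show "\<exists>M. \<forall>i\<ge>M. \<forall>j\<ge>M. N (y i - y j) < e" by blast
    qed (rule y)
    then obtain x where x: "x \<in> S" "(\<lambda>i. N (y i - x)) \<longlonglongrightarrow> 0" by blast
    show "\<exists>x\<in>span (insert v S). (\<lambda>i. N (s i - x)) \<longlonglongrightarrow> 0"
    proof (intro bexI)
      show mem: "x + b *\<^sub>R v \<in> span (insert v S)"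
        using x by (intro span_add span_scale) (auto intro: span_base)
      show "(\<lambda>i. N (s i - (x + b *\<^sub>R v))) \<longlonglongrightarrow> 0"
      proof (rule tendsto_sandwich)
        show "\<forall>\<^sub>F i in sequentially. 0 \<le> N (s i - (x + b *\<^sub>R v))"
          using T.norm_nonneg[OF span_diff[OF s mem]] by simp
        have "N (s i - (x + b *\<^sub>R v)) \<le> N (y i - x) + \<bar>a i - b\<bar> * N v" for i
        proof -
          have eq: "s i - (x + b *\<^sub>R v) = (y i - x) + (a i - b) *\<^sub>R v"
            by (simp add: y_def algebra_simps)
          have "y i - x \<in> U"
            using y x S subspace_diff[OF S.subspace] by blast
          then have "N ((y i - x) + (a i - b) *\<^sub>R v) \<le> N (y i - x) + N ((a i - b) *\<^sub>R v)"
            by (intro norm_triangle subspace_scale[OF subspace v])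
          then show ?thesis
            unfolding eq norm_scaleR[OF v] .
        qed
        then show "\<forall>\<^sub>F i in sequentially.
            N (s i - (x + b *\<^sub>R v)) \<le> N (y i - x) + \<bar>a i - b\<bar> * N v"
          by simp
        have "(\<lambda>i. N (y i - x) + \<bar>a i - b\<bar> * N v) \<longlonglongrightarrow> 0 + \<bar>b - b\<bar> * N v"
          by (intro tendsto_intros x b)
        then show "(\<lambda>i. N (y i - x) + \<bar>a i - b\<bar> * N v) \<longlonglongrightarrow> 0"
          by simp
      qed (rule tendsto_const)
    qed
  qed (use T.norm_eq_zero_iff T.norm_triangle T.norm_scaleR in auto)
qed

lemma banach_on_span_Un_finite:
  assumes "finite B" and "banach_on S N" and "S \<union> B \<subseteq> U"
  shows "banach_on (span (S \<union> B)) N"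
  using \<open>finite B\<close> \<open>S \<union> B \<subseteq> U\<close>
proof (induction B rule: finite_induct)
  case empty
  have "span S = S"
    using banach_on.subspace[OF assms(2)] by (simp add: span_eq_iff)
  then show ?case using assms(2) by (simp only: Un_empty_right)
next
  case (insert v B)
  have "banach_on (span (insert v (span (S \<union> B)))) N"
    using insert span_minimal[OF _ subspace, of "S \<union> B"] by (intro banach_on_span_insert) auto
  moreover have "span (insert v (span (S \<union> B))) = span (S \<union> insert v B)"
  proof
    show "span (insert v (span (S \<union> B))) \<subseteq> span (S \<union> insert v B)"
      using span_mono[of "S \<union> B" "S \<union> insert v B"]
      by (intro span_minimal) (auto intro: span_base)
    show "span (S \<union> insert v B) \<subseteq> span (insert v (span (S \<union> B)))"
      by (intro span_mono) (auto intro: span_base)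
  qed
  ultimately show ?case by simp
qed

end

lemma banach_on_imp_normed_on: "banach_on S N \<Longrightarrow> normed_on S N"
  by (simp add: banach_on_def normed_on_def)

text \<open>Carries completeness of a type-class Banach space over to its isometric image; it is
  applied to the type of the bidual, embedded by restriction to the dual ball.\<close>

lemma banach_on_range:
  fixes j :: "'b::banach \<Rightarrow> 'u::real_vector"
  assumes j: "linear j" and iso: "\<And>x. N (j x) = norm x"
  shows "banach_on (range j) N"
proof
  show "subspace (range j)"
    using linear_subspace_image[OF j subspace_UNIV] .
  have "j x = 0 \<longleftrightarrow> x = 0" for x
    by (metis iso j linear_0 norm_eq_zero)
  then show "N x = 0 \<longleftrightarrow> x = 0" if "x \<in> range j" for x
    using that iso by auto
  show "N (x + y) \<le> N x + N y" if "x \<in> range j" "y \<in> range j" for x y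
    using that iso norm_triangle_ineq by (auto simp flip: linear_add[OF j])
  show "N (r *\<^sub>R x) = \<bar>r\<bar> * N x" if "x \<in> range j" for r x
    using that iso by (auto simp flip: linear_scale[OF j])
next
  fix s :: "nat \<Rightarrow> 'u"
  assume "\<And>i. s i \<in> range j"
    and Cauchy: "\<And>e. e > 0 \<Longrightarrow> \<exists>M. \<forall>i\<ge>M. \<forall>k\<ge>M. N (s i - s k) < e"
  then have "\<forall>i. \<exists>x. s i = j x" by blast
  then obtain t where t: "\<And>i. s i = j (t i)" by metis
  have diff: "N (j x - j y) = norm (x - y)" for x y
    using iso by (simp flip: linear_diff[OF j])
  have "Cauchy t"
    using Cauchy unfolding Cauchy_def dist_norm t diff by blast
  then obtain x where "t \<longlonglongrightarrow> x"
    using Cauchy_convergent_iff convergent_def by blast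
  then have "(\<lambda>i. N (s i - j x)) \<longlonglongrightarrow> 0"
    unfolding t diff by (intro tendsto_norm_zero LIM_zero)
  then show "\<exists>x\<in>range j. (\<lambda>i. N (s i - x)) \<longlonglongrightarrow> 0"
    by blast
qed

subsection \<open>Comparison of widths\<close>

text \<open>Lifting a basis of the range to preimages gives a set \<open>D\<close> that spans a
  complement of the kernel: every \<open>x\<close> agrees with some element of \<open>span D\<close>
  up to a kernel vector. The exchange lemma bounds its size by \<open>card B\<close>.\<close>

lemma codim_le_kernel:
  fixes T :: "'a::real_vector \<Rightarrow> 'b::real_vector"
  assumes T: "linear T" and B: "finite B" "card B \<le> n" "range T \<subseteq> span B"
  shows "codim_le n {x. T x = 0}"
proof -
  obtain C where C: "C \<subseteq> range T" "independent C" "range T \<subseteq> span C"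
    using maximal_independent_subset .
  have fin: "finite C" "card C \<le> card B"
    using independent_span_bound[OF B(1) C(2)] B(3) C(1) by auto
  obtain D where D: "C = T ` D" "finite D" "card D \<le> card C"
    using finite_subset_image[OF fin(1) C(1)] inj_on_iff_eq_card
    by (metis C(1) card_image eq_refl fin(1) finite_imageD subset_image_inj)
  have "x \<in> span ({x. T x = 0} \<union> D)" for x
  proof -
    have "T x \<in> T ` span D"
      using C(3) D(1) linear_span_image[OF T] by blast
    then obtain y where y: "y \<in> span D" "T x = T y" by blast
    then have "x - y \<in> span ({x. T x = 0} \<union> D)"
      by (intro span_base) (simp add: linear_diff[OF T])
    moreover have "y \<in> span ({x. T x = 0} \<union> D)"
      using y span_mono[of D] by blast
    ultimately show ?thesis
      using span_add[of "x - y" _ y] by simp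
  qed
  then show ?thesis
    unfolding codim_le_def using D fin(2) B(2) by (intro exI[of _ D]) auto
qed

lemma gelfand_width_le_linear_width:
  fixes A :: "'a::banach set"
  assumes ext: "isometric_extension S N j"
  shows "gelfand_width n A \<le> linear_width n (j ` A) S N"
  unfolding linear_width_def
proof (rule INF_greatest)
  fix P
  assume fr: "P \<in> finite_rank_operators n S N"
  then have P: "P ` S \<subseteq> S"
    and P_add: "\<And>x y. x \<in> S \<Longrightarrow> y \<in> S \<Longrightarrow> P (x + y) = P x + P y"
    and P_scale: "\<And>r x. x \<in> S \<Longrightarrow> P (r *\<^sub>R x) = r *\<^sub>R P x"
    by (simp_all add: finite_rank_operators_def)
  obtain K where K: "\<forall>x\<in>S. N (P x) \<le> K * N x"
    using fr by (auto simp: finite_rank_operators_def)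
  obtain B where B: "finite B" "card B \<le> n" "P ` S \<subseteq> span B"
    using fr by (auto simp: finite_rank_operators_def)
  have j: "linear j" "\<And>x. j x \<in> S" "\<And>x. N (j x) = norm x"
    using ext by (auto simp: isometric_extension_def)
  interpret normed_on S N
    using ext by (simp add: isometric_extension_def banach_on_imp_normed_on)
  define T where "T x = P (j x)" for x
  have T: "linear T"
    by (intro linearI)
      (simp_all add: T_def linear_add[OF j(1)] linear_scale[OF j(1)] P_add P_scale j(2))
  have TS: "T x \<in> S" for x
    using P j(2) by (auto simp: T_def)
  have bound: "N (T x) \<le> K * norm x" for x
    using K j(2)[of x] by (simp add: T_def flip: j(3))
  define L where "L = {x. T x = 0}"
  have "subspace L"
    unfolding L_def using T by (rule linear_subspace_kernel)
  moreover have "closed L"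
    unfolding closed_sequential_limits
  proof (intro allI impI)
    fix s x
    assume "(\<forall>i. s i \<in> L) \<and> s \<longlonglongrightarrow> x"
    then have s: "\<And>i. T (s i) = 0" and lim: "s \<longlonglongrightarrow> x"
      by (auto simp: L_def)
    \<comment> \<open>\<open>N\<close> is no type-class norm, so closedness is shown by hand:
      \<open>T x = T (x - s i)\<close> bounds \<open>N (T x)\<close> by a sequence tending to zero.
      The limit is left as \<open>norm (x - x)\<close> to match the limit rules.\<close>
    have "N (T x) \<le> K * norm (x - x)"
    proof (rule tendsto_lowerbound)
      show "(\<lambda>i. K * norm (x - s i)) \<longlonglongrightarrow> K * norm (x - x)"
        by (intro tendsto_intros lim)
      have "N (T x) \<le> K * norm (x - s i)" for i
        using bound[of "x - s i"] by (simp add: linear_diff[OF T] s)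
      then show "\<forall>\<^sub>F i in sequentially. N (T x) \<le> K * norm (x - s i)"
        by simp
    qed simp
    then show "x \<in> L"
      using norm_nonneg[OF TS, of x] norm_eq_zero_iff[OF TS, of x] by (simp add: L_def)
  qed
  moreover have "codim_le n L"
    unfolding L_def by (rule codim_le_kernel[OF T B(1,2)]) (use B(3) j(2) in \<open>auto simp: T_def\<close>)
  ultimately have "gelfand_width n A \<le> (SUP x \<in> A \<inter> L. ennreal (norm x))"
    unfolding gelfand_width_def by (intro INF_lower) simp
  also have "\<dots> \<le> (SUP y \<in> j ` A. ennreal (N (y - P y)))"
  proof (rule SUP_least)
    fix x
    assume "x \<in> A \<inter> L"
    then have "norm x = N (j x - P (j x))" "x \<in> A"
      by (auto simp: L_def T_def j(3))
    then show "ennreal (norm x) \<le> (SUP y \<in> j ` A. ennreal (N (y - P y)))"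
      by (intro SUP_upper2[of "j x"]) auto
  qed
  finally show "gelfand_width n A \<le> (SUP y \<in> j ` A. ennreal (N (y - P y)))" .
qed

section \<open>Moving an extension into the second factor of a product type\<close>

lemma linear_width_prod_le:
  fixes S D :: "'b::real_vector set"
  shows "linear_width n ((\<lambda>y. (0, y)) ` D) ({0 :: 'e::real_vector} \<times> S) (N \<circ> snd)
    \<le> linear_width n D S N"
  unfolding linear_width_def
proof (rule INF_greatest)
  fix P
  assume P: "P \<in> finite_rank_operators n S N"
  define P' :: "'e \<times> 'b \<Rightarrow> 'e \<times> 'b" where "P' z = (0, P (snd z))" for z
  obtain B where B: "finite B" "card B \<le> n" "P ` S \<subseteq> span B"
    using P by (auto simp: finite_rank_operators_def)
  have lin: "linear (Pair (0 :: 'e) :: 'b \<Rightarrow> _)"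
    by (intro linearI) (auto simp: scaleR_prod_def)
  have "P' ` ({0} \<times> S) \<subseteq> span (Pair 0 ` B)"
    using B(3) by (auto simp: P'_def linear_span_image[OF lin])
  moreover have "finite (Pair (0 :: 'e) ` B)" "card (Pair (0 :: 'e) ` B) \<le> n"
    using B by (auto intro: order_trans[OF card_image_le])
  ultimately have "\<exists>B'. finite B' \<and> card B' \<le> n \<and> P' ` ({0} \<times> S) \<subseteq> span B'"
    by blast
  then have "P' \<in> finite_rank_operators n ({0} \<times> S) (N \<circ> snd)"
    using P by (auto simp: finite_rank_operators_def P'_def scaleR_prod_def)
  then show "(INF P \<in> finite_rank_operators n ({0 :: 'e} \<times> S) (N \<circ> snd).
      SUP y \<in> (\<lambda>y. (0, y)) ` D. ennreal ((N \<circ> snd) (y - P y))) \<le> (SUP y \<in> D. ennreal (N (y - P y)))"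
    by (rule INF_lower2) (simp add: P'_def image_image)
qed

lemma isometric_extension_snd:
  assumes "isometric_extension S N j"
  shows "isometric_extension ({0 :: 'e::real_vector} \<times> S) (N \<circ> snd) (\<lambda>x. (0, j x))"
proof -
  interpret banach_on S N
    using assms by (simp add: isometric_extension_def)
  have "banach_on ({0 :: 'e} \<times> S) (N \<circ> snd)"
  proof
    show "subspace ({0 :: 'e} \<times> S)"
      using subspace by (intro subspace_Times) auto
  next
    fix s :: "nat \<Rightarrow> 'e \<times> 'a"
    assume s: "\<And>i. s i \<in> {0} \<times> S"
      and *: "\<And>e::real. e > 0 \<Longrightarrow> \<exists>M. \<forall>i\<ge>M. \<forall>j\<ge>M. (N \<circ> snd) (s i - s j) < e"
    have "\<exists>x\<in>S. (\<lambda>i. N (snd (s i) - x)) \<longlonglongrightarrow> 0"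
    proof (rule complete)
      show "snd (s i) \<in> S" for i
        using s[of i] by auto
      show "\<exists>M. \<forall>i\<ge>M. \<forall>j\<ge>M. N (snd (s i) - snd (s j)) < e" if "e > 0" for e :: real
        using *[OF that] by simp
    qed
    then show "\<exists>x\<in>{0} \<times> S. (\<lambda>i. (N \<circ> snd) (s i - x)) \<longlonglongrightarrow> 0"
      by auto
  qed (auto simp: norm_eq_zero_iff norm_triangle norm_scaleR zero_prod_def)
  then show ?thesis
    using assms
    by (auto simp: isometric_extension_def linear_iff scaleR_prod_def)
qed

text \<open>The infimum ranges over extensions inside the product type, so an extension carried by
  \<open>'v\<close> enters it through its copy in \<open>{0} \<times> S\<close>, where each operator
  on \<open>S\<close> has a counterpart with the same error.\<close>

lemma absolute_linear_width_le:
  fixes A :: "'a::banach set" and S :: "'v::real_vector set"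
  assumes "isometric_extension S N j"
  shows "absolute_linear_width TYPE('e::real_vector \<times> 'v) n A \<le> linear_width n (j ` A) S N"
proof -
  have "absolute_linear_width TYPE('e \<times> 'v) n A
      \<le> linear_width n ((\<lambda>x. (0 :: 'e, j x)) ` A) ({0} \<times> S) (N \<circ> snd)"
    unfolding absolute_linear_width_def
    using isometric_extension_snd[OF assms, where ?'e = 'e]
    by (intro INF_lower2[of "({0} \<times> S, N \<circ> snd, \<lambda>x. (0, j x))"]) auto
  also have "\<dots> \<le> linear_width n (j ` A) S N"
    using linear_width_prod_le[of n "j ` A" S N, where ?'e = 'e] by (simp add: image_image)
  finally show ?thesis .
qed

subsection \<open>Bounded functions on the dual unit ball\<close>

lemma sum_fun_apply: "(\<Sum>i\<in>I. f i) x = (\<Sum>i\<in>I. f i x)"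
  for f :: "'i \<Rightarrow> 'x \<Rightarrow> 'y::comm_monoid_add"
  by (induction I rule: infinite_finite_induct) auto

lemma scaleR_fun_apply [simp]: "(r *\<^sub>R f) x = r *\<^sub>R f x"
  by (simp add: scaleR_fun_def)

lemma abs_le_hat_norm:
  assumes "f \<in> hat_space" and "\<psi> \<in> cball 0 1"
  shows "\<bar>f \<psi>\<bar> \<le> hat_norm f"
proof -
  obtain B where "\<forall>y\<in>f ` cball 0 1. norm y \<le> B"
    using assms(1) by (auto simp: hat_space_def bounded_iff)
  then have "bdd_above ((\<lambda>\<phi>. \<bar>f \<phi>\<bar>) ` cball 0 1)"
    by (intro bdd_aboveI[of _ B]) auto
  then show ?thesis
    unfolding hat_norm_def using assms(2) by (intro cSUP_upper)
qed

lemma hat_norm_le: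
  assumes "\<And>\<psi>. \<psi> \<in> cball 0 1 \<Longrightarrow> \<bar>f \<psi>\<bar> \<le> M"
  shows "hat_norm f \<le> M"
proof -
  have "(0 :: 'a dual) \<in> cball 0 1" by simp
  then show ?thesis
    unfolding hat_norm_def using assms by (intro cSUP_least) blast+
qed

lemma hat_spaceI:
  assumes "\<And>\<psi>. \<psi> \<in> cball 0 1 \<Longrightarrow> \<bar>f \<psi>\<bar> \<le> M" and "\<And>\<psi>. \<psi> \<notin> cball 0 1 \<Longrightarrow> f \<psi> = 0"
  shows "f \<in> hat_space"
  unfolding hat_space_def bounded_iff using assms by (auto intro!: exI[of _ M])

lemma hat_space_outside: "f \<in> hat_space \<Longrightarrow> \<psi> \<notin> cball 0 1 \<Longrightarrow> f \<psi> = 0"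
  unfolding hat_space_def by blast

lemma normed_on_hat_space: "normed_on (hat_space :: 'a::banach dual_fun set) hat_norm"
proof
  have add: "f + g \<in> hat_space" if "f \<in> hat_space" "g \<in> hat_space" for f g :: "'a dual_fun"
  proof (rule hat_spaceI)
    show "\<bar>(f + g) \<psi>\<bar> \<le> hat_norm f + hat_norm g" if "\<psi> \<in> cball 0 1" for \<psi>
      using abs_le_hat_norm[of f \<psi>] abs_le_hat_norm[of g \<psi>] that
        \<open>f \<in> hat_space\<close> \<open>g \<in> hat_space\<close> by simp
    show "(f + g) \<psi> = 0" if "\<psi> \<notin> cball 0 1" for \<psi>
      using hat_space_outside[OF \<open>f \<in> hat_space\<close> that] hat_space_outside[OF \<open>g \<in> hat_space\<close> that]
      by simp
  qed
  have scale: "r *\<^sub>R f \<in> hat_space" if "f \<in> hat_space" for r and f :: "'a dual_fun"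
  proof (rule hat_spaceI)
    show "\<bar>(r *\<^sub>R f) \<psi>\<bar> \<le> \<bar>r\<bar> * hat_norm f" if "\<psi> \<in> cball 0 1" for \<psi>
      using abs_le_hat_norm[of f \<psi>] that \<open>f \<in> hat_space\<close> by (simp add: abs_mult mult_left_mono)
    show "(r *\<^sub>R f) \<psi> = 0" if "\<psi> \<notin> cball 0 1" for \<psi>
      using hat_space_outside[OF \<open>f \<in> hat_space\<close> that] by simp
  qed
  have "(0 :: 'a dual_fun) \<in> hat_space"
    by (rule hat_spaceI[of _ 0]) auto
  then show "subspace (hat_space :: 'a dual_fun set)"
    unfolding subspace_def using add scale by blast
  fix f :: "'a dual_fun"
  assume f: "f \<in> hat_space"
  show "hat_norm f = 0 \<longleftrightarrow> f = 0"
  proof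
    assume 0: "hat_norm f = 0"
    show "f = 0"
    proof
      fix \<psi>
      show "f \<psi> = 0 \<psi>"
        \<comment> \<open>The norm sees only the ball; outside it, extension by zero makes the
          representative vanish.\<close>
        using abs_le_hat_norm[OF f, of \<psi>] hat_space_outside[OF f, of \<psi>] 0
        by (cases "\<psi> \<in> cball 0 1") auto
    qed
  next
    assume "f = 0"
    have "\<not> hat_norm f < 0"
      using abs_le_hat_norm[OF f, of 0] by simp
    then show "hat_norm f = 0"
      using hat_norm_le[of f 0] \<open>f = 0\<close> by simp
  qed
  show "hat_norm (f + g) \<le> hat_norm f + hat_norm g" if "g \<in> hat_space" for g
  proof (rule hat_norm_le)
    show "\<bar>(f + g) \<psi>\<bar> \<le> hat_norm f + hat_norm g" if "\<psi> \<in> cball 0 1" for \<psi>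
      using abs_le_hat_norm[OF f that] abs_le_hat_norm[OF \<open>g \<in> hat_space\<close> that] by simp
  qed
  have le: "hat_norm (r *\<^sub>R h) \<le> \<bar>r\<bar> * hat_norm h" if "h \<in> hat_space" for r and h :: "'a dual_fun"
    by (rule hat_norm_le) (simp add: abs_mult abs_le_hat_norm[OF that] mult_left_mono)
  show "hat_norm (r *\<^sub>R f) = \<bar>r\<bar> * hat_norm f" for r
  proof (cases "r = 0")
    case True
    have "0 \<le> hat_norm (r *\<^sub>R f)"
      using abs_le_hat_norm[OF scale[OF f], of 0 r] by simp
    then show ?thesis using le[OF f, of r] True by simp
  next
    case False
    then have "hat_norm f \<le> \<bar>inverse r\<bar> * hat_norm (r *\<^sub>R f)"
      using le[OF scale[OF f, of r], of "inverse r"] by simp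
    then have "\<bar>r\<bar> * hat_norm f \<le> hat_norm (r *\<^sub>R f)"
      using False by (simp add: field_simps)
    then show ?thesis using le[OF f, of r] by simp
  qed
qed

interpretation hat: normed_on hat_space hat_norm
  by (rule normed_on_hat_space)

section \<open>The bidual and the space \<open>bar_space\<close> among the bounded functions\<close>

lemma linear_restrict_ball_blinfun: "linear (\<lambda>F. restrict_ball (blinfun_apply F))"
  by (intro linearI ext) (auto simp: restrict_ball_def blinfun.add_left blinfun.scaleR_left)

lemma hat_norm_restrict_ball_blinfun: "hat_norm (restrict_ball (blinfun_apply F)) = norm F"
proof (rule antisym)
  have le: "\<bar>restrict_ball (blinfun_apply F) \<psi>\<bar> \<le> norm F" if "\<psi> \<in> cball 0 1" for \<psi>
  proof -
    have "\<bar>blinfun_apply F \<psi>\<bar> \<le> norm F * norm \<psi>"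
      using norm_blinfun[of F \<psi>] by simp
    also have "\<dots> \<le> norm F * 1"
      using that by (intro mult_left_mono) auto
    finally show ?thesis by (simp add: restrict_ball_def)
  qed
  then show "hat_norm (restrict_ball (blinfun_apply F)) \<le> norm F"
    by (rule hat_norm_le)
  have hat: "restrict_ball (blinfun_apply F) \<in> hat_space"
    by (rule hat_spaceI[OF le]) (auto simp: restrict_ball_def)
  show "norm F \<le> hat_norm (restrict_ball (blinfun_apply F))"
  proof (rule norm_blinfun_bound)
    show "0 \<le> hat_norm (restrict_ball (blinfun_apply F))"
      using hat by (rule hat.norm_nonneg)
    fix \<psi>
    show "norm (blinfun_apply F \<psi>) \<le> hat_norm (restrict_ball (blinfun_apply F)) * norm \<psi>"
    proof (cases "\<psi> = 0")
      case False
      have "\<bar>restrict_ball (blinfun_apply F) (\<psi> /\<^sub>R norm \<psi>)\<bar> \<le> hat_norm (restrict_ball (blinfun_apply F))"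
        using False by (intro abs_le_hat_norm hat) simp
      then show ?thesis
        using False
        by (simp add: restrict_ball_def blinfun.scaleR_right abs_mult field_simps)
    qed (simp add: blinfun.zero_right)
  qed
qed

lemma banach_on_bidual_space: "banach_on bidual_space hat_norm"
  unfolding bidual_space_def
  by (intro banach_on_range linear_restrict_ball_blinfun hat_norm_restrict_ball_blinfun)

lemma bidual_space_subset_hat_space: "bidual_space \<subseteq> hat_space"
proof
  fix f :: "'a dual_fun"
  assume "f \<in> bidual_space"
  then obtain F where f: "f = restrict_ball (blinfun_apply F)"
    by (auto simp: bidual_space_def)
  show "f \<in> hat_space"
  proof (rule hat_spaceI)
    show "\<bar>f \<psi>\<bar> \<le> norm F" if "\<psi> \<in> cball 0 1" for \<psi>
      using norm_blinfun[of F \<psi>] mult_left_le[of "norm \<psi>" "norm F"] that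
      by (simp add: f restrict_ball_def)
  qed (auto simp: f restrict_ball_def)
qed

text \<open>The inequality \<open>norm x \<le> norm F\<close> is where the norming functional, and
  with it the Hahn-Banach argument, is used.\<close>

lemma bidual_element_of_vector:
  fixes x :: "'a::banach"
  obtains F :: "'a dual dual" where "canonical_embedding x = restrict_ball (blinfun_apply F)"
    and "norm F = norm x"
proof -
  define F :: "'a dual dual" where "F = Blinfun (\<lambda>\<phi>. blinfun_apply \<phi> x)"
  have app: "blinfun_apply F = (\<lambda>\<phi>. blinfun_apply \<phi> x)"
    unfolding F_def by (intro bounded_linear_Blinfun_apply blinfun.bounded_linear_left)
  obtain f :: "'a dual" where f: "norm f \<le> 1" "blinfun_apply f x = norm x"
    by (rule norming_functional_exists)
  have "norm x \<le> norm F * norm f"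
    using norm_blinfun[of F f] f by (simp add: app)
  also have "\<dots> \<le> norm F"
    using f by (simp add: mult_left_le)
  finally have "norm x \<le> norm F" .
  moreover have "norm F \<le> norm x"
  proof (rule norm_blinfun_bound)
    show "norm (blinfun_apply F \<psi>) \<le> norm x * norm \<psi>" for \<psi>
      using norm_blinfun[of \<psi> x] by (simp add: app mult.commute)
  qed simp
  ultimately show ?thesis
    by (intro that[of F]) (auto simp: canonical_embedding_def app)
qed

lemma bar_space_subset_hat_space:
  assumes "\<And>k. k \<in> {1..n} \<Longrightarrow> c k \<in> hat_space"
  shows "bar_space n c \<subseteq> hat_space"
  unfolding bar_space_def
  using assms bidual_space_subset_hat_space subspace_0[OF hat.subspace]
  by (intro span_minimal hat.subspace) (auto simp: bracket_def)

text \<open>\<open>bracket\<close> discards \<open>c k\<close> only when it already lies in the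
  bidual, so the original \<open>c k\<close> is available either way.\<close>

lemma mem_bar_space:
  assumes "k \<in> {1..n}"
  shows "c k \<in> bar_space n c"
proof -
  have "c k \<in> bidual_space \<union> (\<lambda>k. bracket (c k)) ` {1..n}"
  proof (cases "c k \<in> bidual_space")
    case False
    then have "c k = bracket (c k)" by (simp add: bracket_def)
    then show ?thesis using assms by blast
  qed simp
  then show ?thesis
    unfolding bar_space_def by (rule span_base)
qed

lemma isometric_extension_bar_space:
  fixes c :: "nat \<Rightarrow> 'a::banach dual_fun"
  assumes "\<And>k. k \<in> {1..n} \<Longrightarrow> c k \<in> hat_space"
  shows "isometric_extension (bar_space n c) hat_norm canonical_embedding"
  unfolding isometric_extension_def
proof (intro conjI allI)
  show "banach_on (bar_space n c) hat_norm"
    unfolding bar_space_def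
  proof (rule hat.banach_on_span_Un_finite)
    show "bidual_space \<union> (\<lambda>k. bracket (c k)) ` {1..n} \<subseteq> hat_space"
      using bar_space_subset_hat_space[OF assms, of n]
      unfolding bar_space_def by (rule order_trans[OF span_superset])
  qed (simp_all add: banach_on_bidual_space)
  show "linear (canonical_embedding :: 'a \<Rightarrow> _)"
    by (intro linearI ext)
      (auto simp: canonical_embedding_def restrict_ball_def blinfun.add_right blinfun.scaleR_right)
  fix x :: 'a
  obtain F :: "'a dual dual" where F: "canonical_embedding x = restrict_ball (blinfun_apply F)"
      "norm F = norm x"
    by (rule bidual_element_of_vector)
  then show "hat_norm (canonical_embedding x) = norm x"
    by (simp add: hat_norm_restrict_ball_blinfun)
  show "canonical_embedding x \<in> bar_space n c"
    unfolding bar_space_def F by (intro span_base) (auto simp: bidual_space_def)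
qed

section \<open>The rank-n operator whose error is at most the Gelfand width\<close>

text \<open>
  Evaluation at the normalisation of a functional extends that functional from X to the whole
  function space, which replaces the Hahn-Banach extension of the functional.
\<close>

definition eval_extension :: "'a::banach dual \<Rightarrow> 'a dual_fun \<Rightarrow> real"
  where "eval_extension \<phi> f = norm \<phi> * f (\<phi> /\<^sub>R norm \<phi>)"

lemma normalised_mem_cball: "\<phi> /\<^sub>R norm \<phi> \<in> cball 0 1"
  for \<phi> :: "'a::real_normed_vector"
  by (cases "\<phi> = 0") auto

lemma eval_extension_canonical_embedding:
  "eval_extension \<phi> (canonical_embedding x) = blinfun_apply \<phi> x"
proof (cases "\<phi> = 0")
  case False
  then show ?thesis
    using normalised_mem_cball[of \<phi>]
    by (simp add: eval_extension_def canonical_embedding_def restrict_ball_def blinfun.scaleR_left)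
qed (simp add: eval_extension_def)

lemma abs_eval_extension_le:
  "f \<in> hat_space \<Longrightarrow> \<bar>eval_extension \<phi> f\<bar> \<le> norm \<phi> * hat_norm f"
  by (simp add: eval_extension_def abs_mult mult_left_mono abs_le_hat_norm[OF _ normalised_mem_cball])

text \<open>Evaluation at a fixed point is linear and bounded on functions, so the operator is
  linear in \<open>f\<close> even though the \<open>c k\<close> are arbitrary bounded functions. Its
  values lie in the span of at most \<open>n\<close> functions.\<close>

lemma finite_rank_operator_bar_space:
  fixes \<phi> :: "nat \<Rightarrow> 'a::banach dual"
  assumes c: "\<And>k. k \<in> {1..n} \<Longrightarrow> c k \<in> hat_space"
  shows "(\<lambda>f. \<Sum>k=1..n. eval_extension (\<phi> k) f *\<^sub>R c k)
    \<in> finite_rank_operators n (bar_space n c) hat_norm"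
proof -
  let ?P = "\<lambda>f. \<Sum>k=1..n. eval_extension (\<phi> k) f *\<^sub>R c k"
  have sub: "bar_space n c \<subseteq> hat_space"
    using c by (rule bar_space_subset_hat_space)
  have mem: "?P f \<in> span (c ` {1..n})" for f
    by (intro span_sum span_scale span_base) auto
  have "span (c ` {1..n}) \<subseteq> bar_space n c"
    using mem_bar_space[of _ n c] subspace_span by (intro span_minimal) (auto simp: bar_space_def)
  then have "?P ` bar_space n c \<subseteq> bar_space n c"
    using mem by blast
  moreover have "?P (f + g) = ?P f + ?P g" for f g
    by (simp add: eval_extension_def algebra_simps sum.distrib)
  moreover have "?P (r *\<^sub>R f) = r *\<^sub>R ?P f" for r f
    by (simp add: eval_extension_def scaleR_sum_right mult_ac)
  moreover have "hat_norm (?P f) \<le> (\<Sum>k=1..n. norm (\<phi> k) * hat_norm (c k)) * hat_norm f"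
    if "f \<in> bar_space n c" for f
  proof -
    have f: "f \<in> hat_space" using that sub by blast
    have "hat_norm (?P f) \<le> (\<Sum>k=1..n. hat_norm (eval_extension (\<phi> k) f *\<^sub>R c k))"
      using c by (intro hat.norm_sum_le subspace_scale[OF hat.subspace])
    also have "\<dots> = (\<Sum>k=1..n. \<bar>eval_extension (\<phi> k) f\<bar> * hat_norm (c k))"
      using c by (intro sum.cong refl hat.norm_scaleR)
    also have "\<dots> \<le> (\<Sum>k=1..n. norm (\<phi> k) * hat_norm f * hat_norm (c k))"
      using c f by (intro sum_mono mult_right_mono abs_eval_extension_le hat.norm_nonneg)
    finally show ?thesis
      by (simp add: sum_distrib_left sum_distrib_right mult_ac)
  qed
  moreover have "\<exists>B. finite B \<and> card B \<le> n \<and> ?P ` bar_space n c \<subseteq> span B"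
    using mem card_image_le[of "{1..n}" c] by (intro exI[of _ "c ` {1..n}"]) auto
  ultimately show ?thesis
    unfolding finite_rank_operators_def by blast
qed

text \<open>At \<psi> the error function of \<open>x\<close> is the approximation error of \<psi>
  evaluated at \<open>x\<close>. So it is enough to bound, for each \<psi> in the ball, the best
  approximation error in the dual of lin A. If \<open>G\<close> is infinite there is nothing to
  prove.\<close>

lemma linear_width_bar_space_le:
  fixes A :: "'a::banach set" and \<phi> :: "nat \<Rightarrow> 'a dual"
  assumes "convex A" and sym: "\<And>x. x \<in> A \<Longrightarrow> - x \<in> A"
    and G: "(SUP x \<in> {x \<in> A. \<forall>k\<in>{1..n}. blinfun_apply (\<phi> k) x = 0}. ennreal (norm x)) \<le> G"
    and c: "\<And>k. k \<in> {1..n} \<Longrightarrow> c k \<in> hat_space"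
    and best: "\<And>\<psi>. \<psi> \<in> cball 0 1 \<Longrightarrow>
      lin_dual_norm A (\<psi> - (\<Sum>k=1..n. c k \<psi> *\<^sub>R \<phi> k))
        = (INF a :: nat \<Rightarrow> real. lin_dual_norm A (\<psi> - (\<Sum>k=1..n. a k *\<^sub>R \<phi> k)))"
  shows "linear_width n (canonical_embedding ` A) (bar_space n c) hat_norm \<le> G"
proof (cases G)
  case (real M)
  have app: "blinfun_apply (\<psi> - (\<Sum>k=1..n. a k *\<^sub>R \<phi> k)) x
      = blinfun_apply \<psi> x - (\<Sum>k=1..n. a k * blinfun_apply (\<phi> k) x)" for \<psi> a x
    by (simp add: blinfun.diff_left blinfun.sum_left blinfun.scaleR_left)
  have M: "norm x \<le> M" if "x \<in> A" "\<forall>k\<in>{1..n}. blinfun_apply (\<phi> k) x = 0" for x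
  proof -
    have "ennreal (norm x) \<le> G"
      using that G by (auto simp: SUP_le_iff)
    then show ?thesis using real by simp
  qed
  have dual_le: "\<bar>blinfun_apply \<psi> x - (\<Sum>k=1..n. c k \<psi> * blinfun_apply (\<phi> k) x)\<bar> \<le> M"
    if \<psi>: "\<psi> \<in> cball 0 1" and x: "x \<in> A" for \<psi> x
  proof -
    have "\<exists>a. \<forall>x\<in>A. \<bar>blinfun_apply \<psi> x - (\<Sum>k=1..n. a k * blinfun_apply (\<phi> k) x)\<bar> \<le> M"
    proof (rule approx_by_functionals_of_bounded_on_kernels[OF \<open>convex A\<close> sym])
      show "blinfun_apply \<psi> y \<le> M" if "y \<in> A" "\<forall>k\<in>{1..n}. blinfun_apply (\<phi> k) y = 0" for y
        \<comment> \<open>On the common kernel, \<open>norm \<psi> \<le> 1\<close> reduces the value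
          of \<psi> to the norm of the point, which is at most \<open>M\<close>.\<close>
        using M[OF that] norm_blinfun[of \<psi> y] mult_right_mono[of "norm \<psi>" 1 "norm y"] \<psi> by simp
    qed (use real in \<open>auto intro: bounded_linear.linear blinfun.bounded_linear_right\<close>)
    then obtain a where a: "\<forall>x\<in>A. \<bar>blinfun_apply \<psi> x - (\<Sum>k=1..n. a k * blinfun_apply (\<phi> k) x)\<bar> \<le> M"
      by blast
    \<comment> \<open>The coefficients \<open>a\<close> are just some choice with error at most
      \<open>M\<close>; optimality of \<open>c k \<psi>\<close> transfers that bound.\<close>
    have "ennreal \<bar>blinfun_apply \<psi> x - (\<Sum>k=1..n. c k \<psi> * blinfun_apply (\<phi> k) x)\<bar>
        \<le> lin_dual_norm A (\<psi> - (\<Sum>k=1..n. c k \<psi> *\<^sub>R \<phi> k))"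
      unfolding lin_dual_norm_def app using x by (rule SUP_upper)
    also have "\<dots> \<le> lin_dual_norm A (\<psi> - (\<Sum>k=1..n. a k *\<^sub>R \<phi> k))"
      unfolding best[OF \<psi>] by (rule INF_lower) simp
    also have "\<dots> \<le> ennreal M"
      unfolding lin_dual_norm_def app using a by (intro SUP_least ennreal_leI) blast
    finally show ?thesis using real by simp
  qed
  let ?P = "\<lambda>f. \<Sum>k=1..n. eval_extension (\<phi> k) f *\<^sub>R c k"
  have "hat_norm (canonical_embedding x - ?P (canonical_embedding x)) \<le> M" if "x \<in> A" for x
  proof (rule hat_norm_le)
    fix \<psi> :: "'a dual"
    assume \<psi>: "\<psi> \<in> cball 0 1"
    have "canonical_embedding x \<psi> = blinfun_apply \<psi> x"
      using \<psi> by (simp add: canonical_embedding_def restrict_ball_def)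
    then show "\<bar>(canonical_embedding x - ?P (canonical_embedding x)) \<psi>\<bar> \<le> M"
      using dual_le[OF \<psi> that]
      by (simp add: eval_extension_canonical_embedding sum_fun_apply mult.commute)
  qed
  then have le: "(SUP y \<in> canonical_embedding ` A. ennreal (hat_norm (y - ?P y))) \<le> G"
    unfolding real(2) by (intro SUP_least) (auto intro: ennreal_leI)
  have "?P \<in> finite_rank_operators n (bar_space n c) hat_norm"
    using c by (rule finite_rank_operator_bar_space)
  then have "linear_width n (canonical_embedding ` A) (bar_space n c) hat_norm
      \<le> (SUP y \<in> canonical_embedding ` A. ennreal (hat_norm (y - ?P y)))"
    unfolding linear_width_def by (rule INF_lower)
  also note le
  finally show ?thesis .
qed simp

theorem theorem1:
  fixes A :: "'a::banach set"
    and n :: nat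
    and \<phi> :: "nat \<Rightarrow> 'a dual"
    and c :: "nat \<Rightarrow> 'a dual_fun"
  assumes "convex A"
    and "\<And>x. x \<in> A \<Longrightarrow> - x \<in> A"
    and "compact A"
    and "(SUP (x, y) \<in> A \<times> A. ennreal (norm (x - y))) < \<infinity>"
    and "\<And>\<epsilon>::real. \<epsilon> > 0 \<Longrightarrow>
      (SUP x \<in> {x \<in> A. \<forall>k\<in>{1..n}. blinfun_apply (\<phi> k) x = 0}. ennreal (norm x))
        \<le> gelfand_width n A + ennreal \<epsilon>"
    and "\<And>k. k \<in> {1..n} \<Longrightarrow> c k \<in> hat_space"
    and "\<And>\<psi>. \<psi> \<in> cball 0 1 \<Longrightarrow>
      lin_dual_norm A (\<psi> - (\<Sum>k=1..n. c k \<psi> *\<^sub>R \<phi> k))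
        = (INF a :: nat \<Rightarrow> real. lin_dual_norm A (\<psi> - (\<Sum>k=1..n. a k *\<^sub>R \<phi> k)))"
  shows "linear_width n (canonical_embedding ` A) (bar_space n c) hat_norm
    = absolute_linear_width TYPE('e::real_vector \<times> 'a dual_fun) n A"
proof (rule antisym)
  have "linear_width n (canonical_embedding ` A) (bar_space n c) hat_norm \<le> gelfand_width n A"
    \<comment> \<open>Since \<epsilon> is arbitrary, the supremum over the common kernel is itself
      at most the Gelfand width, which takes the role of \<open>G\<close>.\<close>
    using assms(1,2) ennreal_le_epsilon[OF assms(5)] assms(6,7) by (rule linear_width_bar_space_le)
  also have "\<dots> \<le> absolute_linear_width TYPE('e \<times> 'a dual_fun) n A"
    unfolding absolute_linear_width_def
    by (rule INF_greatest) (auto intro: gelfand_width_le_linear_width)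
  finally show "linear_width n (canonical_embedding ` A) (bar_space n c) hat_norm
    \<le> absolute_linear_width TYPE('e \<times> 'a dual_fun) n A" .
  show "absolute_linear_width TYPE('e \<times> 'a dual_fun) n A
    \<le> linear_width n (canonical_embedding ` A) (bar_space n c) hat_norm"
    using assms(6) by (intro absolute_linear_width_le isometric_extension_bar_space)
qed

end
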